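(* Let $F\in L^2_{\mathbb{X}}$ have the infinite Hoeffding decomposition $F=\sum_{M\in\mathcal{P}_{fin}(\mathbb{N})}F_M$. Then, for any $k\in\mathbb{N}$, the infinite Hoeffding decomposition of $D_kF$ is given by $$D_kF=\sum_{M\in\mathcal{P}_{fin}(\mathbb{N}):\,k\in M}F_M.$$
   Context: $\mathbb{N}=\{1,2,\ldots\}$ and $\mathcal{P}_{fin}(\mathbb{N})$ is the collection of finite subsets of $\mathbb{N}$ (including $\emptyset$). Let $(E_n,\mathcal{B}_n,\mu_n)$, $n\in\mathbb{N}$, be arbitrary probability spaces, and let $\mathbb{X}=(X_n)_{n\in\mathbb{N}}$ be a sequence of independent random variables on a probability space $(\Omega,\mathcal{A},\mathbb{P})$, where $X_n$ takes values in $E_n$ and has distribution $\mu_n$. Let $\mathcal{F}=\sigma(\mathbb{X})$ and $L^2_{\mathbb{X}}=L^2(\Omega,\mathcal{F},\mathbb{P})$ (real-valued). For $M\subseteq\mathbb{N}$ let $\mathcal{F}_M=\sigma(X_j,j\in M)$ and for $k\in\mathbb{N}$ let $\mathcal{G}_k=\sigma(X_j,j\neq k)$. Infinite Hoeffding decomposition: for $F\in L^2_{\mathbb{X}}$ and $M\in\mathcal{P}_{fin}(\mathbb{N})$ put $F_M:=\sum_{L\subseteq M}(-1)^{|M|-|L|}\mathbb{E}[F\,|\,\mathcal{F}_L]$. Then $F=\sum_{M\in\mathcal{P}_{fin}(\mathbb{N})}F_M$ with unconditional convergence in $L^2(\mathbb{P})$ and pairwise orthogonal summands; $F_M$ is $\mathcal{F}_M$-measurable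 and $\mathbb{E}[F_M|\mathcal{F}_K]=0$ a.s. unless $M\subseteq K$. This representation is a.s. unique and is called the infinite Hoeffding decomposition of $F$. (So the claim says that the Hoeffding component $(D_kF)_M$ equals $F_M$ if $k\in M$ and $0$ otherwise.) For $F\in L^2_{\mathbb{X}}$ and $k\in\mathbb{N}$, $D_kF:=F-\mathbb{E}[F\,|\,\mathcal{G}_k]$. *)

theory Defs
  imports "HOL-Probability.Probability"
begin

text \<open>
  Throughout, \<open>P\<close> is the probability space on \<open>\<Omega>\<close>, \<open>E n\<close> is the \<open>n\<close>-th state space together with
  its probability measure, \<open>X\<close> is the sequence of random variables, and indices range over
  \<open>{1..} :: nat set\<close>. The finite index sets are thus the elements of \<open>Fpow {1..}\<close>.
\<close>

text \<open>The sigma-algebra \<open>\<sigma>(X\<^sub>j, j \<in> J)\<close>. Only its space and measurable sets matter; it is trivial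
  for empty \<open>J\<close>.\<close>

definition sigma_of ::
  "'a measure \<Rightarrow> (nat \<Rightarrow> 'b measure) \<Rightarrow> (nat \<Rightarrow> 'a \<Rightarrow> 'b) \<Rightarrow> nat set \<Rightarrow> 'a measure" where
  "sigma_of P E X J = sigma (space P) (\<Union>j\<in>J. {X j -` A \<inter> space P | A. A \<in> sets (E j)})"

text \<open>Square-integrable functions (not equivalence classes) measurable with respect to a
  sub-sigma-algebra \<open>G\<close> of \<open>P\<close>.\<close>

definition L2_space :: "'a measure \<Rightarrow> 'a measure \<Rightarrow> ('a \<Rightarrow> real) set" where
  "L2_space P G = {f \<in> borel_measurable G. integrable P (\<lambda>\<omega>. (f \<omega>)\<^sup>2)}"

definition L2_norm :: "'a measure \<Rightarrow> ('a \<Rightarrow> real) \<Rightarrow> real" where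
  "L2_norm P f = sqrt (\<integral>\<omega>. (f \<omega>)\<^sup>2 \<partial>P)"

definition L2_X ::
  "'a measure \<Rightarrow> (nat \<Rightarrow> 'b measure) \<Rightarrow> (nat \<Rightarrow> 'a \<Rightarrow> 'b) \<Rightarrow> ('a \<Rightarrow> real) set" where
  "L2_X P E X = L2_space P (sigma_of P E X {1..})"

text \<open>Unconditional convergence in \<open>L\<^sup>2(P)\<close> of \<open>\<Sum>i\<in>I. f i\<close> to \<open>s\<close>, as convergence of the net of
  finite partial sums (as in \<open>has_sum\<close>). Square-integrability is demanded explicitly because the
  Bochner integral of a non-integrable function is \<open>0\<close>.\<close>

definition has_L2_sum :: "'a measure \<Rightarrow> ('i \<Rightarrow> 'a \<Rightarrow> real) \<Rightarrow> 'i set \<Rightarrow> ('a \<Rightarrow> real) \<Rightarrow> bool" where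
  "has_L2_sum P f I s \<longleftrightarrow>
     s \<in> L2_space P P \<and> (\<forall>i\<in>I. f i \<in> L2_space P P) \<and>
     ((\<lambda>S. L2_norm P (\<lambda>\<omega>. s \<omega> - (\<Sum>i\<in>S. f i \<omega>))) \<longlongrightarrow> 0) (finite_subsets_at_top I)"

definition Hoeffding_component ::
  "'a measure \<Rightarrow> (nat \<Rightarrow> 'b measure) \<Rightarrow> (nat \<Rightarrow> 'a \<Rightarrow> 'b) \<Rightarrow> ('a \<Rightarrow> real) \<Rightarrow> nat set \<Rightarrow> 'a \<Rightarrow> real" where
  "Hoeffding_component P E X F M =
     (\<lambda>\<omega>. \<Sum>L\<in>Pow M. (-1) ^ (card M - card L) * real_cond_exp P (sigma_of P E X L) F \<omega>)"

text \<open>The family \<open>(f M)\<close>, for \<open>M\<close> in \<open>Fpow {1..}\<close>, is (a version of) the infinite Hoeffding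
  decomposition of \<open>F\<close>: its members agree almost surely with the components given by the explicit
  formula, and it has all the properties that characterise the decomposition.\<close>

definition infinite_Hoeffding_decomposition ::
  "'a measure \<Rightarrow> (nat \<Rightarrow> 'b measure) \<Rightarrow> (nat \<Rightarrow> 'a \<Rightarrow> 'b) \<Rightarrow> ('a \<Rightarrow> real) \<Rightarrow>
     (nat set \<Rightarrow> 'a \<Rightarrow> real) \<Rightarrow> bool" where
  "infinite_Hoeffding_decomposition P E X F f \<longleftrightarrow>
     F \<in> L2_X P E X \<and>
     (\<forall>M\<in>Fpow {1..}. AE \<omega> in P. f M \<omega> = Hoeffding_component P E X F M \<omega>) \<and>
     (\<forall>M\<in>Fpow {1..}. f M \<in> L2_space P (sigma_of P E X M)) \<and>
     (\<forall>M\<in>Fpow {1..}. \<forall>K\<subseteq>{1..}. \<not> M \<subseteq> K \<longrightarrow>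
        (AE \<omega> in P. real_cond_exp P (sigma_of P E X K) (f M) \<omega> = 0)) \<and>
     (\<forall>M\<in>Fpow {1..}. \<forall>N\<in>Fpow {1..}. M \<noteq> N \<longrightarrow> (\<integral>\<omega>. f M \<omega> * f N \<omega> \<partial>P) = 0) \<and>
     has_L2_sum P f (Fpow {1..}) F"

definition D_op ::
  "'a measure \<Rightarrow> (nat \<Rightarrow> 'b measure) \<Rightarrow> (nat \<Rightarrow> 'a \<Rightarrow> 'b) \<Rightarrow> nat \<Rightarrow> ('a \<Rightarrow> real) \<Rightarrow> 'a \<Rightarrow> real" where
  "D_op P E X k F = (\<lambda>\<omega>. F \<omega> - real_cond_exp P (sigma_of P E X ({1..} - {k})) F \<omega>)"

end

theory Submission
  imports Defs
begin

text \<open>By independence, \<open>\<E>[\<E>[F | \<A> K] | \<A> J] = \<E>[F | \<A> (J \<inter> K)]\<close>. Conditioning a component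
  \<open>F\<^sub>M\<close> on \<open>\<A> K\<close> with \<open>j \<in> M - K\<close> therefore makes the terms of \<open>L\<close> and \<open>L \<union> {j}\<close> in its alternating sum
  cancel, which gives orthogonality. By Moebius inversion, the components over \<open>L \<subseteq> {1..n}\<close> add up to
  \<open>\<E>[F | \<A> {1..n}]\<close>, which tends to \<open>F\<close> in \<open>L\<^sup>2\<close>; by Pythagoras, adding further components only
  decreases the error, so the convergence is unconditional. Finally, with \<open>K = {1..} - {k}\<close>, the \<open>M\<close>-th component of
  \<open>D\<^sub>k F\<close> is \<open>F\<^sub>M - \<E>[F\<^sub>M | \<A> K]\<close>, and the conditional expectation is \<open>0\<close> if \<open>k \<in> M\<close> and \<open>F\<^sub>M\<close> otherwise.\<close>

section \<open>Alternating sums over power sets and Moebius inversion\<close>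

text \<open>The subsets of \<open>insert j N\<close> are the sets \<open>L\<close> and
  \<open>insert j L\<close> with \<open>L \<subseteq> N\<close>. Inserting \<open>j\<close> on both
  sides keeps the difference of the cardinalities, while a subset without \<open>j\<close> picks up
  one extra sign.\<close>

lemma alternating_sum_Pow_insert:
  fixes h :: "'a set \<Rightarrow> real"
  assumes "finite N" "j \<notin> N"
  shows "(\<Sum>L\<in>Pow (insert j N). (-1) ^ (card (insert j N) - card L) * h L) =
         (\<Sum>L\<in>Pow N. (-1) ^ (card N - card L) * (h (insert j L) - h L))"
proof -
  have disj: "Pow N \<inter> insert j ` Pow N = {}"
    using assms by auto
  have inj: "inj_on (insert j) (Pow N)"
    using assms by (intro inj_on_inverseI[where g = "\<lambda>L. L - {j}"]) auto
  have "(\<Sum>L\<in>Pow (insert j N). (-1) ^ (card (insert j N) - card L) * h L) =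
      (\<Sum>L\<in>Pow N. (-1) ^ (card (insert j N) - card L) * h L) +
      (\<Sum>L\<in>Pow N. (-1) ^ (card (insert j N) - card (insert j L)) * h (insert j L))"
    unfolding Pow_insert using assms
    by (subst sum.union_disjoint) (auto simp: disj sum.reindex[OF inj])
  also have "\<dots> = (\<Sum>L\<in>Pow N. (-1) ^ (card N - card L) * (h (insert j L) - h L))"
    unfolding sum.distrib[symmetric]
  proof (rule sum.cong)
    fix L assume "L \<in> Pow N"
    then have "L \<subseteq> N" by simp
    then have "finite L" "j \<notin> L" "card L \<le> card N"
      using assms finite_subset[of L N] card_mono[of N L] by auto
    \<comment> \<open>The exponents are truncated differences of naturals, so
      \<open>card L \<le> card N\<close> is what lets the extra \<open>Suc\<close> come out as a
      factor -1.\<close>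
    then show "(- 1) ^ (card (insert j N) - card L) * h L +
        (- 1) ^ (card (insert j N) - card (insert j L)) * h (insert j L) =
        (- 1) ^ (card N - card L) * (h (insert j L) - h L)"
      using assms by (simp add: Suc_diff_le algebra_simps)
  qed simp
  finally show ?thesis .
qed

text \<open>Each \<open>L\<close> without \<open>j\<close> cancels against
  \<open>insert j L\<close>. This is applied to conditional expectations on
  \<open>\<A> (K \<inter> L)\<close> with \<open>j\<close> outside \<open>K\<close>.\<close>

lemma alternating_sum_Pow_eq_0:
  fixes h :: "'a set \<Rightarrow> real"
  assumes "finite M" "j \<in> M" and "\<And>L. L \<subseteq> M \<Longrightarrow> h (insert j L) = h L"
  shows "(\<Sum>L\<in>Pow M. (-1) ^ (card M - card L) * h L) = 0"
proof -
  have "insert j (M - {j}) = M"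
    using assms by auto
  then have "(\<Sum>L\<in>Pow M. (-1) ^ (card M - card L) * h L) =
      (\<Sum>L\<in>Pow (M - {j}). (-1) ^ (card (M - {j}) - card L) * (h (insert j L) - h L))"
    using alternating_sum_Pow_insert[of "M - {j}" j h] assms by simp
  also have "\<dots> = 0"
    using assms(3) by (intro sum.neutral) (auto simp: subset_iff)
  finally show ?thesis .
qed

text \<open>In the induction step, the sets containing \<open>j\<close> contribute the alternating
  sums of the shifted function \<open>h (insert j L)\<close> minus those of \<open>h\<close>. The
  latter cancel against the sets without \<open>j\<close>, and the induction hypothesis for the
  shifted function leaves \<open>h (insert j M)\<close>; hence \<open>h\<close> must be
  arbitrary.\<close>

lemma Moebius_inversion_Pow:
  fixes h :: "'a set \<Rightarrow> real"
  assumes "finite M"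
  shows "(\<Sum>N\<in>Pow M. \<Sum>L\<in>Pow N. (-1) ^ (card N - card L) * h L) = h M"
  using assms
proof (induction M arbitrary: h)
  case (insert j M)
  let ?g = "\<lambda>h N. \<Sum>L\<in>Pow N. (-1) ^ (card N - card L) * h L"
  have disj: "Pow M \<inter> insert j ` Pow M = {}"
    using insert by auto
  have inj: "inj_on (insert j) (Pow M)"
    using insert.hyps by (intro inj_on_inverseI[where g = "\<lambda>L. L - {j}"]) auto
  have "(\<Sum>N\<in>Pow (insert j M). ?g h N) =
      (\<Sum>N\<in>Pow M. ?g h N) + (\<Sum>N\<in>Pow M. ?g h (insert j N))"
    unfolding Pow_insert[of j M] using insert
    by (subst sum.union_disjoint) (auto simp: disj sum.reindex[OF inj])
  also have "(\<Sum>N\<in>Pow M. ?g h (insert j N)) =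
      (\<Sum>N\<in>Pow M. ?g (\<lambda>L. h (insert j L)) N - ?g h N)"
  proof (rule sum.cong)
    fix N assume "N \<in> Pow M"
    then have "finite N" "j \<notin> N"
      using insert finite_subset[of N M] by auto
    then show "?g h (insert j N) = ?g (\<lambda>L. h (insert j L)) N - ?g h N"
      using alternating_sum_Pow_insert[of N j h]
      by (simp add: right_diff_distrib sum_subtractf)
  qed simp
  finally show ?case
    using insert.IH[of "\<lambda>L. h (insert j L)"] by (simp add: sum_subtractf)
qed simp

section \<open>Square-integrable functions and conditional expectation\<close>

lemma L2_spaceI:
  "f \<in> borel_measurable G \<Longrightarrow> integrable M (\<lambda>x. (f x)\<^sup>2) \<Longrightarrow> f \<in> L2_space M G"
  by (simp add: L2_space_def)

lemma L2_space_measurable: "f \<in> L2_space M G \<Longrightarrow> f \<in> borel_measurable G"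
  by (simp add: L2_space_def)

lemma L2_space_square_integrable: "f \<in> L2_space M G \<Longrightarrow> integrable M (\<lambda>x. (f x)\<^sup>2)"
  by (simp add: L2_space_def)

lemma L2_space_mono: "subalgebra H G \<Longrightarrow> f \<in> L2_space M G \<Longrightarrow> f \<in> L2_space M H"
  by (auto simp: L2_space_def intro: measurable_from_subalg)

lemma L2_space_zero [simp]: "(\<lambda>x. 0) \<in> L2_space M G"
  by (simp add: L2_space_def)

lemma L2_space_cmult: "f \<in> L2_space M G \<Longrightarrow> (\<lambda>x. c * f x) \<in> L2_space M G"
  by (auto simp: L2_space_def power_mult_distrib)

lemma integrable_mult_L2:
  assumes "f \<in> L2_space M M" "g \<in> L2_space M M"
  shows "integrable M (\<lambda>x. f x * g x)"
proof (rule Bochner_Integration.integrable_bound)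
  show "integrable M (\<lambda>x. (f x)\<^sup>2 + (g x)\<^sup>2)"
    using assms by (simp add: L2_space_def)
  show "(\<lambda>x. f x * g x) \<in> borel_measurable M"
    using assms by (auto simp: L2_space_def)
  have "\<bar>a * b\<bar> \<le> a\<^sup>2 + b\<^sup>2" for a b :: real
  proof -
    have "0 \<le> \<bar>a\<bar> * \<bar>b\<bar>" by simp
    then show ?thesis
      using sum_squares_bound[of "\<bar>a\<bar>" "\<bar>b\<bar>"] unfolding abs_mult power2_abs by linarith
  qed
  then show "AE x in M. norm (f x * g x) \<le> norm ((f x)\<^sup>2 + (g x)\<^sup>2)"
    by (intro AE_I2) (simp add: abs_of_nonneg)
qed

lemma L2_space_add:
  assumes "subalgebra M G" "f \<in> L2_space M G" "g \<in> L2_space M G"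
  shows "(\<lambda>x. f x + g x) \<in> L2_space M G"
proof (rule L2_spaceI)
  show "(\<lambda>x. f x + g x) \<in> borel_measurable G"
    using assms by (auto simp: L2_space_def)
  have "f \<in> L2_space M M" "g \<in> L2_space M M"
    using assms L2_space_mono by blast+
  then show "integrable M (\<lambda>x. (f x + g x)\<^sup>2)"
    using integrable_mult_L2[of f M g]
    by (simp add: power2_sum L2_space_square_integrable mult.assoc)
qed

lemma L2_space_diff:
  assumes "subalgebra M G" "f \<in> L2_space M G" "g \<in> L2_space M G"
  shows "(\<lambda>x. f x - g x) \<in> L2_space M G"
  using L2_space_add[OF assms(1,2) L2_space_cmult[OF assms(3), of "-1"]] by simp

lemma L2_space_sum:
  assumes "subalgebra M G" "\<And>i. i \<in> I \<Longrightarrow> f i \<in> L2_space M G"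
  shows "(\<lambda>x. \<Sum>i\<in>I. f i x) \<in> L2_space M G"
  using assms(2)
proof (induction I rule: infinite_finite_induct)
  case (insert i I)
  then show ?case
    using L2_space_add[OF assms(1), of "f i" "\<lambda>x. \<Sum>i\<in>I. f i x"] by simp
qed simp_all

lemma subalgebra_refl [simp]: "subalgebra M M"
  by (simp add: subalgebra_def)

text \<open>This replaces the triangle inequality, so that the approximation arguments can work with
  squared distances only.\<close>

lemma integral_sum_square_le:
  assumes "f \<in> L2_space M M" "g \<in> L2_space M M"
  shows "(\<integral>x. (f x + g x)\<^sup>2 \<partial>M) \<le> 2 * (\<integral>x. (f x)\<^sup>2 \<partial>M) + 2 * (\<integral>x. (g x)\<^sup>2 \<partial>M)"
proof -
  have "(\<integral>x. (f x + g x)\<^sup>2 \<partial>M) \<le> (\<integral>x. 2 * (f x)\<^sup>2 + 2 * (g x)\<^sup>2 \<partial>M)"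
  proof (rule integral_mono)
    show "integrable M (\<lambda>x. (f x + g x)\<^sup>2)"
      using L2_space_add[OF subalgebra_refl assms] by (simp add: L2_space_def)
    show "integrable M (\<lambda>x. 2 * (f x)\<^sup>2 + 2 * (g x)\<^sup>2)"
      using assms by (simp add: L2_space_def)
    show "(f x + g x)\<^sup>2 \<le> 2 * (f x)\<^sup>2 + 2 * (g x)\<^sup>2" for x
      using sum_squares_bound[of "f x" "g x"] by (simp add: power2_sum)
  qed
  then show ?thesis
    using assms by (simp add: L2_space_def)
qed

context prob_space
begin

text \<open>The restriction of a probability measure is finite, which gives access to the locale in
  which conditional expectations are developed.\<close>

lemma sigma_finite_subalgebraI:
  assumes "subalgebra M G"
  shows "sigma_finite_subalgebra M G"
proof -
  interpret finite_measure_subalgebra M G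
    by standard (rule assms)
  show ?thesis by unfold_locales
qed

lemma integrable_L2: "f \<in> L2_space M M \<Longrightarrow> integrable M f"
  by (simp add: L2_space_def square_integrable_imp_integrable)

text \<open>Conditional Jensen inequality for the square function.\<close>

lemma cond_exp_L2:
  assumes "subalgebra M G" "f \<in> L2_space M M"
  shows "real_cond_exp M G f \<in> L2_space M G"
proof (rule L2_spaceI)
  interpret sigma_finite_subalgebra M G
    by (rule sigma_finite_subalgebraI[OF assms(1)])
  show "integrable M (\<lambda>x. (real_cond_exp M G f x)\<^sup>2)"
    using assms(2) convex_power2
    by (intro integrable_convex_cond_exp[where I = UNIV and q = "\<lambda>x. x\<^sup>2"])
       (simp_all add: integrable_L2 L2_space_square_integrable)
qed simp

text \<open>Conditional expectation is the orthogonal projection onto the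
  \<open>G\<close>-measurable functions: the residual \<open>u\<close> is orthogonal to
  \<open>v\<close>, and Pythagoras gives the squared distance to \<open>h\<close> as the sum of
  their squared norms.\<close>

lemma cond_exp_best_approximation:
  assumes G: "subalgebra M G" and f: "f \<in> L2_space M M" and h: "h \<in> L2_space M G"
  shows "(\<integral>x. (f x - real_cond_exp M G f x)\<^sup>2 \<partial>M) \<le> (\<integral>x. (f x - h x)\<^sup>2 \<partial>M)"
proof -
  interpret sigma_finite_subalgebra M G
    by (rule sigma_finite_subalgebraI[OF G])
  define g where "g = real_cond_exp M G f"
  define u where "u = (\<lambda>x. f x - g x)"
  define v where "v = (\<lambda>x. g x - h x)"
  have g: "g \<in> L2_space M G"
    unfolding g_def by (rule cond_exp_L2[OF G f])
  have vG: "v \<in> L2_space M G"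
    unfolding v_def by (rule L2_space_diff[OF G g h])
  then have v: "v \<in> L2_space M M" and g': "g \<in> L2_space M M"
    using g L2_space_mono[OF G] by auto
  have u: "u \<in> L2_space M M"
    unfolding u_def by (rule L2_space_diff[OF subalgebra_refl f g'])
  have "(\<integral>x. v x * u x \<partial>M) = (\<integral>x. v x * f x \<partial>M) - (\<integral>x. v x * g x \<partial>M)"
    using integrable_mult_L2[OF v f] integrable_mult_L2[OF v g'] by (simp add: u_def right_diff_distrib)
  \<comment> \<open>The factor \<open>v\<close> is \<open>G\<close>-measurable, so testing against
    it does not distinguish \<open>f\<close> from its conditional expectation.\<close>
  also have "(\<integral>x. v x * g x \<partial>M) = (\<integral>x. v x * f x \<partial>M)"
    unfolding g_def using integrable_mult_L2[OF v f] vG f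
    by (intro real_cond_exp_intg(2)) (auto simp: L2_space_def)
  finally have orth: "(\<integral>x. v x * u x \<partial>M) = 0" by simp
  have "(\<integral>x. (f x - h x)\<^sup>2 \<partial>M) = (\<integral>x. (u x)\<^sup>2 + 2 * (v x * u x) + (v x)\<^sup>2 \<partial>M)"
    by (simp add: u_def v_def power2_eq_square algebra_simps)
  also have "\<dots> = (\<integral>x. (u x)\<^sup>2 \<partial>M) + (\<integral>x. (v x)\<^sup>2 \<partial>M)"
    using u v integrable_mult_L2[OF v u] orth by (simp add: L2_space_square_integrable)
  finally show ?thesis
    by (simp add: u_def g_def)
qed

lemma indicator_L2:
  assumes "subalgebra M G" "A \<in> sets G"
  shows "(indicator A :: 'a \<Rightarrow> real) \<in> L2_space M G"
proof (rule L2_spaceI)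
  have "A \<in> sets M"
    using assms by (auto simp: subalgebra_def)
  then show "integrable M (\<lambda>x. (indicator A x :: real)\<^sup>2)"
    by (simp add: power2_eq_square less_top[symmetric] flip: indicator_inter_arith)
qed (use assms in simp)

end

section \<open>L2 approximation along an increasing sequence of sigma-algebras\<close>

locale subalgebra_sequence = prob_space M for M :: "'a measure" +
  fixes Fs :: "nat \<Rightarrow> 'a measure"
  assumes subalgebra_Fs: "subalgebra M (Fs n)"
    and Fs_mono: "m \<le> n \<Longrightarrow> subalgebra (Fs n) (Fs m)"
begin

text \<open>This is the L2 closure of the union of the spaces \<open>L2_space M (Fs n)\<close>.
  Showing that it contains everything measurable for the generated sigma-algebra plays the role of
  L2 martingale convergence.\<close>

definition L2_approximable :: "('a \<Rightarrow> real) \<Rightarrow> bool" where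
  "L2_approximable f \<longleftrightarrow> f \<in> L2_space M M \<and>
     (\<forall>\<epsilon>>0. \<exists>n. \<exists>h\<in>L2_space M (Fs n). (\<integral>x. (f x - h x)\<^sup>2 \<partial>M) < \<epsilon>)"

lemma L2_approximable_L2: "L2_approximable f \<Longrightarrow> f \<in> L2_space M M"
  by (simp add: L2_approximable_def)

lemma L2_approximable_limit:
  assumes f: "f \<in> L2_space M M"
    and lim: "\<And>\<epsilon>. \<epsilon> > 0 \<Longrightarrow> \<exists>g. L2_approximable g \<and> (\<integral>x. (f x - g x)\<^sup>2 \<partial>M) < \<epsilon>"
  shows "L2_approximable f"
  unfolding L2_approximable_def
proof (intro conjI allI impI f)
  fix \<epsilon> :: real assume "\<epsilon> > 0"
  \<comment> \<open>Two errors below \<open>\<epsilon> / 4\<close>, each doubled by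
    \<open>integral_sum_square_le\<close>, add up to less than \<open>\<epsilon>\<close>.\<close>
  then obtain g where g: "L2_approximable g" "(\<integral>x. (f x - g x)\<^sup>2 \<partial>M) < \<epsilon> / 4"
    using lim[of "\<epsilon> / 4"] by auto
  with \<open>\<epsilon> > 0\<close> obtain n h where h: "h \<in> L2_space M (Fs n)" "(\<integral>x. (g x - h x)\<^sup>2 \<partial>M) < \<epsilon> / 4"
    unfolding L2_approximable_def by (meson divide_pos_pos zero_less_numeral)
  have "h \<in> L2_space M M"
    using L2_space_mono[OF subalgebra_Fs h(1)] .
  then have "(\<integral>x. ((f x - g x) + (g x - h x))\<^sup>2 \<partial>M) \<le>
      2 * (\<integral>x. (f x - g x)\<^sup>2 \<partial>M) + 2 * (\<integral>x. (g x - h x)\<^sup>2 \<partial>M)"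
    using f L2_approximable_L2[OF g(1)] by (intro integral_sum_square_le L2_space_diff) auto
  then show "\<exists>n. \<exists>h\<in>L2_space M (Fs n). (\<integral>x. (f x - h x)\<^sup>2 \<partial>M) < \<epsilon>"
    using g(2) h by (intro exI[of _ n] bexI[of _ h]) auto
qed

lemma L2_approximable_add:
  assumes f: "L2_approximable f" and g: "L2_approximable g"
  shows "L2_approximable (\<lambda>x. f x + g x)"
  unfolding L2_approximable_def
proof (intro conjI allI impI)
  have L2: "f \<in> L2_space M M" "g \<in> L2_space M M"
    using f g by (auto simp: L2_approximable_L2)
  then show "(\<lambda>x. f x + g x) \<in> L2_space M M"
    by (intro L2_space_add) auto
  fix \<epsilon> :: real assume "\<epsilon> > 0"
  with f obtain m h where h: "h \<in> L2_space M (Fs m)" "(\<integral>x. (f x - h x)\<^sup>2 \<partial>M) < \<epsilon> / 4"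
    unfolding L2_approximable_def by (meson divide_pos_pos zero_less_numeral)
  from g \<open>\<epsilon> > 0\<close> obtain n k where k: "k \<in> L2_space M (Fs n)" "(\<integral>x. (g x - k x)\<^sup>2 \<partial>M) < \<epsilon> / 4"
    unfolding L2_approximable_def by (meson divide_pos_pos zero_less_numeral)
  \<comment> \<open>Monotonicity moves both approximants to a common stage, where they can be
    added.\<close>
  have "h \<in> L2_space M (Fs (max m n))" "k \<in> L2_space M (Fs (max m n))"
    using h(1) k(1) Fs_mono L2_space_mono max.cobounded1 max.cobounded2 by blast+
  then have "(\<lambda>x. h x + k x) \<in> L2_space M (Fs (max m n))"
    by (intro L2_space_add subalgebra_Fs)
  moreover have "h \<in> L2_space M M" "k \<in> L2_space M M"
    using L2_space_mono[OF subalgebra_Fs h(1)] L2_space_mono[OF subalgebra_Fs k(1)] .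
  then have "(\<integral>x. ((f x - h x) + (g x - k x))\<^sup>2 \<partial>M) \<le>
      2 * (\<integral>x. (f x - h x)\<^sup>2 \<partial>M) + 2 * (\<integral>x. (g x - k x)\<^sup>2 \<partial>M)"
    using L2 by (intro integral_sum_square_le L2_space_diff) auto
  then have "(\<integral>x. ((f x + g x) - (h x + k x))\<^sup>2 \<partial>M) < \<epsilon>"
    using h(2) k(2) by (simp add: algebra_simps)
  ultimately show "\<exists>n. \<exists>h\<in>L2_space M (Fs n). (\<integral>x. (f x + g x - h x)\<^sup>2 \<partial>M) < \<epsilon>"
    by (intro exI[of _ "max m n"] bexI[of _ "\<lambda>x. h x + k x"])
qed

lemma L2_approximable_cmult:
  assumes f: "L2_approximable f"
  shows "L2_approximable (\<lambda>x. c * f x)"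
  unfolding L2_approximable_def
proof (intro conjI allI impI)
  show "(\<lambda>x. c * f x) \<in> L2_space M M"
    using f by (intro L2_space_cmult L2_approximable_L2)
  fix \<epsilon> :: real assume "\<epsilon> > 0"
  \<comment> \<open>Scaling the tolerance by \<open>c\<^sup>2 + 1\<close> rather than
    \<open>c\<^sup>2\<close> covers \<open>c = 0\<close>.\<close>
  moreover have "c\<^sup>2 + 1 > 0"
    by (simp add: add_nonneg_pos)
  ultimately obtain n h where h: "h \<in> L2_space M (Fs n)"
    "(\<integral>x. (f x - h x)\<^sup>2 \<partial>M) < \<epsilon> / (c\<^sup>2 + 1)"
    using f unfolding L2_approximable_def by (meson divide_pos_pos)
  have "(\<integral>x. (c * f x - c * h x)\<^sup>2 \<partial>M) = c\<^sup>2 * (\<integral>x. (f x - h x)\<^sup>2 \<partial>M)"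
    by (simp add: right_diff_distrib[symmetric] power_mult_distrib)
  also have "\<dots> \<le> (c\<^sup>2 + 1) * (\<integral>x. (f x - h x)\<^sup>2 \<partial>M)"
    by (intro mult_right_mono) auto
  also have "\<dots> < \<epsilon>"
    using h(2) \<open>c\<^sup>2 + 1 > 0\<close> by (simp add: field_simps)
  finally show "\<exists>n. \<exists>h\<in>L2_space M (Fs n). (\<integral>x. (c * f x - h x)\<^sup>2 \<partial>M) < \<epsilon>"
    using L2_space_cmult[OF h(1)] by (intro exI[of _ n] bexI[of _ "\<lambda>x. c * h x"])
qed

lemma L2_approximable_of_L2:
  assumes "f \<in> L2_space M (Fs n)"
  shows "L2_approximable f"
  unfolding L2_approximable_def
proof (intro conjI allI impI)
  show "f \<in> L2_space M M"
    using L2_space_mono[OF subalgebra_Fs] assms .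
  show "\<exists>n. \<exists>h\<in>L2_space M (Fs n). (\<integral>x. (f x - h x)\<^sup>2 \<partial>M) < \<epsilon>" if "\<epsilon> > 0" for \<epsilon>
    using assms that by (intro exI[of _ n] bexI[of _ f]) auto
qed

lemma L2_approximable_zero: "L2_approximable (\<lambda>x. 0)"
  by (rule L2_approximable_of_L2[of _ 0]) simp

lemma L2_approximable_sum:
  fixes f :: "'i \<Rightarrow> 'a \<Rightarrow> real"
  assumes "\<And>i. i \<in> I \<Longrightarrow> L2_approximable (f i)"
  shows "L2_approximable (\<lambda>x. \<Sum>i\<in>I. f i x)"
  using assms
proof (induction I rule: infinite_finite_induct)
  case (insert i I)
  then show ?case
    using L2_approximable_add[of "f i" "\<lambda>x. \<Sum>i\<in>I. f i x"] by simp
qed (simp_all add: L2_approximable_zero)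

text \<open>Dynkin's pi-lambda argument: the union of the \<open>Fs n\<close> is stable under
  intersections because the sequence increases, and the sets with approximable indicator are closed
  under complements and countable disjoint unions.\<close>

lemma L2_approximable_indicator:
  assumes A: "A \<in> sigma_sets (space M) (\<Union>n. sets (Fs n))"
  shows "L2_approximable (indicator A)"
proof -
  have space: "space (Fs n) = space M" for n
    using subalgebra_Fs by (simp add: subalgebra_def)
  have sub: "(\<Union>n. sets (Fs n)) \<subseteq> sets M"
    using subalgebra_Fs by (auto simp: subalgebra_def)
  have "Int_stable (\<Union>n. sets (Fs n))"
  proof (rule Int_stableI)
    fix A B assume "A \<in> (\<Union>n. sets (Fs n))" "B \<in> (\<Union>n. sets (Fs n))"
    then obtain m n where "A \<in> sets (Fs m)" "B \<in> sets (Fs n)" by auto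
    then have "A \<in> sets (Fs (max m n))" "B \<in> sets (Fs (max m n))"
      using Fs_mono[of m "max m n"] Fs_mono[of n "max m n"] by (auto simp: subalgebra_def)
    then show "A \<inter> B \<in> (\<Union>n. sets (Fs n))" by auto
  qed
  moreover have "(\<Union>n. sets (Fs n)) \<subseteq> Pow (space M)"
    using sub sets.space_closed by blast
  ultimately show ?thesis
    using A
  proof (induction rule: sigma_sets_induct_disjoint)
    case (basic A)
    then show ?case
      using L2_approximable_of_L2 indicator_L2[OF subalgebra_Fs] by blast
  next
    case empty
    show ?case
      using L2_approximable_zero by (simp add: indicator_def[abs_def])
  next
    case (compl A)
    have "L2_approximable (indicator (space M))"
      using sets.top[of "Fs 0"] unfolding space
      by (intro L2_approximable_of_L2 indicator_L2[OF subalgebra_Fs])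
    then have "L2_approximable (\<lambda>x. indicator (space M) x + (-1) * indicator A x)"
      using compl by (intro L2_approximable_add L2_approximable_cmult)
    moreover have "A \<subseteq> space M"
      using compl sub by (metis sets.sets_into_space sets.sigma_sets_subset subsetD)
    then have "(\<lambda>x. indicator (space M) x + (-1) * indicator A x) = (indicator (space M - A) :: 'a \<Rightarrow> real)"
      by (auto simp: fun_eq_iff indicator_def)
    ultimately show ?case by simp
  next
    case (union A)
    have A: "A i \<in> sets M" for i
      using union(2) sub sets.sigma_sets_subset[OF sub] by blast
    then have UA: "(\<Union>i. A i) \<in> sets M" by blast
    show ?case
    proof (rule L2_approximable_limit)
      show "indicator (\<Union>i. A i) \<in> L2_space M M"
        by (rule indicator_L2[OF subalgebra_refl UA])
      fix \<epsilon> :: real assume "\<epsilon> > 0"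
      \<comment> \<open>By continuity from below the finite unions exhaust the measure of the whole
        union. The measure of what is left over is exactly the squared L2 distance of the
        indicators.\<close>
      have "(\<lambda>n. measure M (\<Union>i<n. A i)) \<longlonglongrightarrow> measure M (\<Union>n. \<Union>i<n. A i)"
        using A by (intro finite_Lim_measure_incseq incseq_SucI UN_mono) auto
      moreover have "(\<Union>n. \<Union>i<n. A i) = (\<Union>i. A i)" by auto
      ultimately have "eventually (\<lambda>n. measure M (\<Union>i. A i) - \<epsilon> < measure M (\<Union>i<n. A i)) sequentially"
        using \<open>\<epsilon> > 0\<close> by (intro order_tendstoD(1)) auto
      then obtain n where n: "measure M (\<Union>i. A i) - measure M (\<Union>i<n. A i) < \<epsilon>"
        using eventually_happens'[OF sequentially_bot] by (force simp: algebra_simps)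
      have eq: "(\<Sum>i<n. indicator (A i) x) = (indicator (\<Union>i<n. A i) x :: real)" for x
        using union(1) by (intro indicator_UN_disjoint[symmetric]) (auto simp: disjoint_family_on_def)
      have "L2_approximable (\<lambda>x. indicator (\<Union>i<n. A i) x)"
        unfolding eq[symmetric] using union by (intro L2_approximable_sum)
      moreover have "(\<integral>x. (indicator (\<Union>i. A i) x - indicator (\<Union>i<n. A i) x :: real)\<^sup>2 \<partial>M) =
          (\<integral>x. indicator ((\<Union>i. A i) - (\<Union>i<n. A i)) x \<partial>M)"
        by (intro Bochner_Integration.integral_cong) (auto simp: indicator_def)
      moreover have "\<dots> = measure M (\<Union>i. A i) - measure M (\<Union>i<n. A i)"
      proof -
        have "(\<Union>i<n. A i) \<in> sets M" "(\<Union>i<n. A i) \<subseteq> (\<Union>i. A i)"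
          using A by auto
        then have "measure M ((\<Union>i. A i) - (\<Union>i<n. A i)) = measure M (\<Union>i. A i) - measure M (\<Union>i<n. A i)"
          using UA by (intro finite_measure_Diff)
        then show ?thesis
          using sets.sets_into_space[OF UA] by (simp add: Int_absorb2 Diff_subset[THEN subset_trans])
      qed
      ultimately show "\<exists>g. L2_approximable g \<and>
          (\<integral>x. (indicator (\<Union>i. A i) x - g x)\<^sup>2 \<partial>M) < \<epsilon>"
        using n by (intro exI[of _ "indicator (\<Union>i<n. A i)"]) auto
    qed
  qed
qed

text \<open>Passage from indicators to nonnegative functions by the usual measure-theoretic
  induction, then to \<open>f\<close> through its positive and negative parts.\<close>

lemma L2_approximable_generated:
  assumes f: "f \<in> L2_space M (sigma (space M) (\<Union>n. sets (Fs n)))"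
  shows "L2_approximable f"
proof -
  let ?S = "sigma (space M) (\<Union>n. sets (Fs n))"
  have sub: "(\<Union>n. sets (Fs n)) \<subseteq> sets M"
    using subalgebra_Fs by (auto simp: subalgebra_def)
  have closed: "(\<Union>n. sets (Fs n)) \<subseteq> Pow (space M)"
    using sub sets.space_closed by blast
  have S: "subalgebra M ?S"
    using sets.sigma_sets_subset[OF sub] closed by (simp add: subalgebra_def)
  have space_S: "space ?S = space M"
    using S by (simp add: subalgebra_def)
  have nonneg: "L2_approximable u"
    if "u \<in> borel_measurable ?S" "\<And>x. 0 \<le> u x" "integrable M (\<lambda>x. (u x)\<^sup>2)" for u
    using that
  proof (induction rule: borel_measurable_induct_real)
    case (set A)
    then show ?case
      using L2_approximable_indicator closed by (simp add: sets_measure_of)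
  next
    case (mult u c)
    show ?case
    \<comment> \<open>Square-integrability of \<open>c * u\<close> yields that of \<open>u\<close>
      only if \<open>c\<close> is nonzero.\<close>
    proof (cases "c = 0")
      case True
      then show ?thesis
        using L2_approximable_zero by simp
    next
      case False
      then have "integrable M (\<lambda>x. (u x)\<^sup>2)"
        using mult.prems by (simp add: power_mult_distrib)
      then show ?thesis
        using mult.IH by (intro L2_approximable_cmult)
    qed
  next
    case (add u v)
    have meas: "u \<in> borel_measurable M" "v \<in> borel_measurable M"
      using add.hyps by (auto intro: measurable_from_subalg[OF S])
    \<comment> \<open>Both summands are nonnegative, so the square of each is dominated by the
      square of the sum.\<close>
    have "integrable M (\<lambda>x. (u x)\<^sup>2)" "integrable M (\<lambda>x. (v x)\<^sup>2)"
      using meas add.hyps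
      by (auto intro!: Bochner_Integration.integrable_bound[OF add.prems] power_mono)
    then show ?case
      using add.IH by (intro L2_approximable_add)
  next
    case (seq U)
    have meas: "U i \<in> borel_measurable M" "u \<in> borel_measurable M" for i
      using seq.hyps seq.prems that(1) by (auto intro: measurable_from_subalg[OF S])
    have le: "U i x \<le> u x" if "x \<in> space M" for i x
      using seq.hyps that unfolding space_S by (intro incseq_le) (auto simp: incseq_def le_fun_def)
    \<comment> \<open>Since \<open>0 \<le> U i x \<le> u x\<close>, the squared errors are dominated
      by the square of \<open>u\<close>.\<close>
    have "(\<lambda>i. \<integral>x. (u x - U i x)\<^sup>2 \<partial>M) \<longlonglongrightarrow> (\<integral>x. 0 \<partial>M)"
    proof (rule integral_dominated_convergence)
      show "AE x in M. (\<lambda>i. (u x - U i x)\<^sup>2) \<longlonglongrightarrow> 0"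
      proof (rule AE_I2)
        fix x assume "x \<in> space M"
        then have "(\<lambda>i. (u x - U i x)\<^sup>2) \<longlonglongrightarrow> (u x - u x)\<^sup>2"
          using seq.hyps unfolding space_S by (intro tendsto_intros) auto
        then show "(\<lambda>i. (u x - U i x)\<^sup>2) \<longlonglongrightarrow> 0" by simp
      qed
      show "AE x in M. norm ((u x - U i x)\<^sup>2) \<le> (u x)\<^sup>2" for i
        using le seq.hyps by (intro AE_I2) (auto intro!: power_mono)
      show "integrable M (\<lambda>x. (u x)\<^sup>2)"
        by (rule seq.prems)
    qed (use meas in auto)
    then have lim: "(\<lambda>i. \<integral>x. (u x - U i x)\<^sup>2 \<partial>M) \<longlonglongrightarrow> 0" by simp
    have "integrable M (\<lambda>x. (U i x)\<^sup>2)" for i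
      using meas le seq.hyps
      by (intro Bochner_Integration.integrable_bound[OF seq.prems]) (auto intro!: power_mono)
    then have U: "L2_approximable (U i)" for i
      using seq.IH by blast
    show ?case
    proof (rule L2_approximable_limit)
      show "u \<in> L2_space M M"
        using meas seq.prems by (intro L2_spaceI)
      fix \<epsilon> :: real assume "\<epsilon> > 0"
      with lim have "eventually (\<lambda>i. (\<integral>x. (u x - U i x)\<^sup>2 \<partial>M) < \<epsilon>) sequentially"
        by (rule order_tendstoD)
      then show "\<exists>g. L2_approximable g \<and> (\<integral>x. (u x - g x)\<^sup>2 \<partial>M) < \<epsilon>"
        using U by (auto simp: eventually_sequentially)
    qed
  qed
  have meas: "f \<in> borel_measurable ?S"
    using f by (rule L2_space_measurable)
  \<comment> \<open>The values 1 and -1 of \<open>c\<close> give the positive and the negative part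
    at once.\<close>
  have int: "integrable M (\<lambda>x. (max 0 (c * f x))\<^sup>2)" if "\<bar>c\<bar> = 1" for c
  proof (rule Bochner_Integration.integrable_bound[OF L2_space_square_integrable[OF f]])
    show "(\<lambda>x. (max 0 (c * f x))\<^sup>2) \<in> borel_measurable M"
      using measurable_from_subalg[OF S meas] by simp
    have "(max 0 (c * y))\<^sup>2 \<le> y\<^sup>2" for y
      using that by (auto simp: max_def abs_if split: if_splits)
    then show "AE x in M. norm ((max 0 (c * f x))\<^sup>2) \<le> norm ((f x)\<^sup>2)"
      by simp
  qed
  have "L2_approximable (\<lambda>x. max 0 (1 * f x) + (-1) * max 0 (-1 * f x))"
    using meas int[of 1] int[of "-1"]
    by (intro L2_approximable_add L2_approximable_cmult nonneg) auto
  moreover have "(\<lambda>x. max 0 (1 * f x) + (-1) * max 0 (-1 * f x)) = f"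
    by (auto simp: fun_eq_iff)
  ultimately show ?thesis by simp
qed

end

section \<open>Conditional expectation along an independent sequence\<close>

lemma sets_sigma_of:
  "sets (sigma_of P E X J) =
     sigma_sets (space P) (\<Union>j\<in>J. {X j -` A \<inter> space P | A. A \<in> sets (E j)})"
  unfolding sigma_of_def by (intro sets_measure_of) auto

lemma space_sigma_of [simp]: "space (sigma_of P E X J) = space P"
  unfolding sigma_of_def by (intro space_measure_of) auto

lemma subalgebra_sigma_of_mono:
  assumes "J \<subseteq> K"
  shows "subalgebra (sigma_of P E X K) (sigma_of P E X J)"
proof -
  have "sets (sigma_of P E X J) \<subseteq> sets (sigma_of P E X K)"
    unfolding sets_sigma_of using assms by (intro sigma_sets_mono') auto
  then show ?thesis
    by (simp add: subalgebra_def)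
qed

locale independent_sequence = prob_space P for P :: "'a measure" +
  fixes E :: "nat \<Rightarrow> 'b measure" and X :: "nat \<Rightarrow> 'a \<Rightarrow> 'b"
  assumes indep: "indep_vars E X {1..}"
begin

abbreviation \<A> :: "nat set \<Rightarrow> 'a measure" where
  "\<A> J \<equiv> sigma_of P E X J"

lemma subalgebra_sigma_of:
  assumes "J \<subseteq> {1..}"
  shows "subalgebra P (\<A> J)"
proof -
  have "(\<Union>j\<in>J. {X j -` A \<inter> space P | A. A \<in> sets (E j)}) \<subseteq> sets P"
    using indep assms by (auto simp: indep_vars_def2 intro!: measurable_sets)
  then show ?thesis
    by (simp add: subalgebra_def sets_sigma_of sets.sigma_sets_subset)
qed

text \<open>The preimages under a single \<open>X j\<close> are stable under intersections, so
  independence passes from these generators to the sigma-algebras of disjoint blocks of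
  indices.\<close>

lemma indep_set_sigma_of:
  assumes "J \<subseteq> {1..}" "K \<subseteq> {1..}" "J \<inter> K = {}"
  shows "indep_set (sets (\<A> J)) (sets (\<A> K))"
proof -
  let ?G = "\<lambda>j. {X j -` A \<inter> space P | A. A \<in> sets (E j)}"
  \<comment> \<open>Indexing the two blocks by booleans through \<open>case_bool\<close> matches the
    definition of \<open>indep_set\<close>.\<close>
  have "indep_sets (\<lambda>b. sigma_sets (space P) (\<Union>j\<in>case_bool J K b. ?G j)) UNIV"
  proof (rule indep_sets_collect_sigma)
    have "indep_sets ?G {1..}"
      using indep by (simp add: indep_vars_def2)
    then show "indep_sets ?G (\<Union>b\<in>UNIV. case_bool J K b)"
      by (rule indep_sets_mono_index[rotated]) (use assms in \<open>auto split: bool.splits\<close>)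
    show "Int_stable (?G j)" for j
    proof (rule Int_stableI, clarsimp)
      fix A B assume "A \<in> sets (E j)" "B \<in> sets (E j)"
      then show "\<exists>C. X j -` A \<inter> space P \<inter> (X j -` B \<inter> space P) = X j -` C \<inter> space P \<and> C \<in> sets (E j)"
        by (intro exI[of _ "A \<inter> B"]) auto
    qed
    show "disjoint_family_on (case_bool J K) UNIV"
      using assms by (auto simp: disjoint_family_on_def split: bool.splits)
  qed
  then show ?thesis
    unfolding indep_set_def sets_sigma_of
    by (rule indep_sets_cong[THEN iffD1, rotated -1]) (auto split: bool.splits)
qed

lemma integral_mult_indicator_indep:
  assumes JK: "J \<subseteq> {1..}" "K \<subseteq> {1..}" "J \<inter> K = {}"
    and f: "integrable P f" "f \<in> borel_measurable (\<A> J)" and C: "C \<in> sets (\<A> K)"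
  shows "(\<integral>x. f x * indicator C x \<partial>P) = (\<integral>x. f x \<partial>P) * prob C"
proof -
  let ?i = "indicator C :: 'a \<Rightarrow> real"
  have CP: "C \<in> sets P"
    using C subalgebra_sigma_of[OF JK(2)] by (auto simp: subalgebra_def)
  \<comment> \<open>The sigma-algebra generated by an \<open>\<A> L\<close>-measurable function lies
    in \<open>\<A> L\<close>. Independence of \<open>\<A> J\<close> and \<open>\<A> K\<close> thus
    makes \<open>f\<close> and the indicator of \<open>C\<close> independent random variables, and
    the expectation of their product factors.\<close>
  have "sigma_sets (space P) {g -` A \<inter> space P |A. A \<in> sets borel} \<subseteq> sets (\<A> L)"
    if "g \<in> borel_measurable (\<A> L)" for g :: "'a \<Rightarrow> real" and L
  proof -
    have "{g -` A \<inter> space (\<A> L) |A. A \<in> sets borel} \<subseteq> sets (\<A> L)"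
      using measurable_sets[OF that] by auto
    from sets.sigma_sets_subset[OF this] show ?thesis by simp
  qed
  then have "indep_set (sigma_sets (space P) {f -` A \<inter> space P |A. A \<in> sets borel})
      (sigma_sets (space P) {?i -` A \<inter> space P |A. A \<in> sets borel})"
    using indep_set_sigma_of[OF JK] f(2) C unfolding indep_sets2_eq
    by (meson borel_measurable_indicator subset_iff subset_trans)
  then have "indep_var borel f borel ?i"
    using f CP by (simp add: indep_var_eq)
  then have "(\<integral>x. f x * ?i x \<partial>P) = (\<integral>x. f x \<partial>P) * (\<integral>x. ?i x \<partial>P)"
    using f CP by (intro indep_var_lebesgue_integral) (auto simp: less_top[symmetric])
  then show ?thesis
    using CP sets.sets_into_space[OF CP] by (simp add: Int_absorb2)
qed

lemma Int_stable_sigma_of_Int: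
  "Int_stable {B \<inter> C | B C. B \<in> sets (\<A> J) \<and> C \<in> sets (\<A> K)}"
proof (rule Int_stableI)
  fix S T assume "S \<in> {B \<inter> C | B C. B \<in> sets (\<A> J) \<and> C \<in> sets (\<A> K)}"
    "T \<in> {B \<inter> C | B C. B \<in> sets (\<A> J) \<and> C \<in> sets (\<A> K)}"
  then obtain B C B' C' where "S = B \<inter> C" "T = B' \<inter> C'" "B \<in> sets (\<A> J)" "B' \<in> sets (\<A> J)"
      "C \<in> sets (\<A> K)" "C' \<in> sets (\<A> K)"
    by auto
  then have "S \<inter> T = (B \<inter> B') \<inter> (C \<inter> C')" "B \<inter> B' \<in> sets (\<A> J)" "C \<inter> C' \<in> sets (\<A> K)"
    by auto
  then show "S \<inter> T \<in> {B \<inter> C | B C. B \<in> sets (\<A> J) \<and> C \<in> sets (\<A> K)}"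
    by blast
qed

text \<open>Every generator lies in \<open>\<A> J\<close> or in \<open>\<A> K\<close>; taking
  \<open>space P\<close> as the other factor writes it as an intersection of the required
  form.\<close>

lemma sets_sigma_of_Un_subset:
  "sets (\<A> (J \<union> K)) \<subseteq>
     sigma_sets (space P) {B \<inter> C | B C. B \<in> sets (\<A> J) \<and> C \<in> sets (\<A> K)}"
  (is "_ \<subseteq> sigma_sets _ ?R")
  unfolding sets_sigma_of[of P E X "J \<union> K"]
proof (rule sigma_sets_mono', rule subsetI)
  fix A assume A: "A \<in> (\<Union>j\<in>J \<union> K. {X j -` A \<inter> space P | A. A \<in> sets (E j)})"
  then have "A \<in> sets (\<A> J) \<or> A \<in> sets (\<A> K)"
    unfolding sets_sigma_of by (auto intro!: sigma_sets.Basic)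
  moreover have "A \<inter> space P = A" "space P \<inter> A = A"
    using A by auto
  moreover have "space P \<in> sets (\<A> J)" "space P \<in> sets (\<A> K)"
    using sets.top[of "\<A> J"] sets.top[of "\<A> K"] by simp_all
  ultimately show "A \<in> ?R"
    by (metis (mono_tags, lifting) mem_Collect_eq)
qed

text \<open>For measurable \<open>f\<close>, the integrals of both sides agree on \<open>B \<inter> C\<close> with \<open>B \<in> \<A> (J \<inter> K)\<close> and
  \<open>C \<in> \<A> (J - K)\<close>, because the factor \<open>P C\<close> splits off by independence; such sets generate \<open>\<A> J\<close>.\<close>

lemma cond_exp_sigma_of_measurable:
  assumes JK: "J \<subseteq> {1..}" "K \<subseteq> {1..}" and f: "integrable P f" "f \<in> borel_measurable (\<A> K)"
  shows "AE x in P. real_cond_exp P (\<A> J) f x = real_cond_exp P (\<A> (J \<inter> K)) f x"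
proof -
  have sub: "subalgebra P (\<A> J)" "subalgebra P (\<A> K)" "subalgebra P (\<A> (J \<inter> K))" "subalgebra P (\<A> (J - K))"
    using JK by (auto intro!: subalgebra_sigma_of)
  interpret J: sigma_finite_subalgebra P "\<A> J"
    by (rule sigma_finite_subalgebraI[OF sub(1)])
  interpret JK: sigma_finite_subalgebra P "\<A> (J \<inter> K)"
    by (rule sigma_finite_subalgebraI[OF sub(3)])
  define g where "g = real_cond_exp P (\<A> (J \<inter> K)) f"
  have g: "integrable P g" "g \<in> borel_measurable (\<A> (J \<inter> K))"
    unfolding g_def using f by (auto intro: JK.real_cond_exp_int)
  let ?R = "{B \<inter> C | B C. B \<in> sets (\<A> (J \<inter> K)) \<and> C \<in> sets (\<A> (J - K))}"
  have R: "?R \<subseteq> sets P"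
    using sub by (auto simp: subalgebra_def)
  \<comment> \<open>Equality of the total integrals is what the complement case of the Dynkin
    induction needs.\<close>
  have space: "(\<integral>x. f x \<partial>P) = (\<integral>x. g x \<partial>P)"
    unfolding g_def using f by (simp add: JK.real_cond_exp_int)
  have eq: "(\<integral>x. indicator A x * f x \<partial>P) = (\<integral>x. indicator A x * g x \<partial>P)"
    if A: "A \<in> sigma_sets (space P) ?R" for A
  proof -
    have int: "integrable P (\<lambda>x. indicator A x * f x)" "integrable P (\<lambda>x. indicator A x * g x)"
      if "A \<in> sets P" for A
      using integrable_mult_indicator[OF that f(1)] integrable_mult_indicator[OF that g(1)] by simp_all
    have "?R \<subseteq> Pow (space P)"
      using R sets.space_closed by blast
    from Int_stable_sigma_of_Int this A show ?thesis
    proof (induction rule: sigma_sets_induct_disjoint)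
      case (basic A)
      then obtain B C where A: "A = B \<inter> C" "B \<in> sets (\<A> (J \<inter> K))" "C \<in> sets (\<A> (J - K))"
        by auto
      have B: "B \<in> sets P" "B \<in> sets (\<A> K)"
        using A(2) sub subalgebra_sigma_of_mono[of "J \<inter> K" K P E X] by (auto simp: subalgebra_def)
      have "(\<integral>x. indicator A x * f x \<partial>P) = (\<integral>x. (indicator B x * f x) * indicator C x \<partial>P)"
        by (simp add: A(1) indicator_inter_arith mult_ac)
      \<comment> \<open>As \<open>B\<close> also belongs to \<open>\<A> K\<close>, the function
        \<open>indicator B x * f x\<close> is \<open>\<A> K\<close>-measurable, and \<open>K\<close>
        is disjoint from \<open>J - K\<close>.\<close>
      also have "\<dots> = (\<integral>x. indicator B x * f x \<partial>P) * prob C"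
        using JK A(3) int[OF B(1)] B(2) f(2)
        by (intro integral_mult_indicator_indep[of K "J - K"]) auto
      also have "(\<integral>x. indicator B x * f x \<partial>P) = (\<integral>x. indicator B x * g x \<partial>P)"
        using JK.real_cond_exp_intA[OF f(1) A(2)] by (simp add: set_lebesgue_integral_def g_def)
      also have "\<dots> * prob C = (\<integral>x. (indicator B x * g x) * indicator C x \<partial>P)"
        using JK A(2,3) int[OF B(1)] g(2)
        by (intro integral_mult_indicator_indep[of "J \<inter> K" "J - K", symmetric]) auto
      also have "\<dots> = (\<integral>x. indicator A x * g x \<partial>P)"
        by (simp add: A(1) indicator_inter_arith mult_ac)
      finally show ?case .
    next
      case empty
      show ?case by simp
    next
      case (compl A)
      then have A: "A \<in> sets P"
        using sets.sigma_sets_subset[OF R] by blast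
      have "(\<integral>x. indicator (space P - A) x * h x \<partial>P) = (\<integral>x. h x \<partial>P) - (\<integral>x. indicator A x * h x \<partial>P)"
        if "integrable P h" "integrable P (\<lambda>x. indicator A x * h x)" for h :: "'a \<Rightarrow> real"
        unfolding Bochner_Integration.integral_diff[OF that, symmetric]
        by (intro Bochner_Integration.integral_cong) (auto simp: indicator_def)
      then show ?case
        using f(1) g(1) int[OF A] compl.IH space by simp
    next
      case (union A)
      then have A: "A i \<in> sets P" for i
        using sets.sigma_sets_subset[OF R] by blast
      then have UA: "(\<Union>i. A i) \<in> sets P" by blast
      have "(\<integral>x. indicator (\<Union>i. A i) x * h x \<partial>P) = (\<Sum>i. \<integral>x. indicator (A i) x * h x \<partial>P)"
        if "integrable P (\<lambda>x. indicator (\<Union>i. A i) x * h x)" for h :: "'a \<Rightarrow> real"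
        using lebesgue_integral_countable_add[of A P h] A union.hyps that
        by (simp add: set_lebesgue_integral_def set_integrable_def disjoint_family_on_def)
      then show ?case
        using int[OF UA] union.IH by simp
    qed
  qed
  have sets_J: "sets (\<A> J) \<subseteq> sigma_sets (space P) ?R"
    using sets_sigma_of_Un_subset[of "J \<inter> K" "J - K"] by (simp add: Int_Diff_Un)
  show ?thesis
    unfolding g_def[symmetric]
  proof (rule J.real_cond_exp_charact)
    show "(\<integral>x\<in>A. f x \<partial>P) = (\<integral>x\<in>A. g x \<partial>P)" if "A \<in> sets (\<A> J)" for A
      using eq sets_J that by (auto simp: set_lebesgue_integral_def)
    show "g \<in> borel_measurable (\<A> J)"
      using measurable_from_subalg[OF subalgebra_sigma_of_mono g(2)] by blast
  qed (use f g in auto)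
qed

text \<open>The inner conditional expectation is \<open>\<A> K\<close>-measurable, so
  \<open>\<A> J\<close> may be replaced by \<open>\<A> (J \<inter> K)\<close>; the tower property
  then removes the inner conditioning.\<close>

lemma cond_exp_sigma_of_Int:
  assumes JK: "J \<subseteq> {1..}" "K \<subseteq> {1..}" and f: "integrable P f"
  shows "AE x in P. real_cond_exp P (\<A> J) (real_cond_exp P (\<A> K) f) x = real_cond_exp P (\<A> (J \<inter> K)) f x"
proof -
  have sub: "subalgebra P (\<A> K)" "subalgebra P (\<A> (J \<inter> K))"
    using JK by (auto intro!: subalgebra_sigma_of)
  interpret K: sigma_finite_subalgebra P "\<A> K"
    by (rule sigma_finite_subalgebraI[OF sub(1)])
  interpret JK: sigma_finite_subalgebra P "\<A> (J \<inter> K)"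
    by (rule sigma_finite_subalgebraI[OF sub(2)])
  have "AE x in P. real_cond_exp P (\<A> J) (real_cond_exp P (\<A> K) f) x =
      real_cond_exp P (\<A> (J \<inter> K)) (real_cond_exp P (\<A> K) f) x"
    using f JK by (intro cond_exp_sigma_of_measurable) (auto intro: K.real_cond_exp_int)
  moreover have "AE x in P. real_cond_exp P (\<A> (J \<inter> K)) (real_cond_exp P (\<A> K) f) x =
      real_cond_exp P (\<A> (J \<inter> K)) f x"
    using f by (intro JK.real_cond_exp_nested_subalg sub subalgebra_sigma_of_mono) auto
  ultimately show ?thesis by auto
qed

section \<open>The infinite Hoeffding decomposition\<close>

lemma component_L2:
  assumes "M \<subseteq> {1..}" "f \<in> L2_space P P"
  shows "Hoeffding_component P E X f M \<in> L2_space P (\<A> M)"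
  unfolding Hoeffding_component_def
proof (intro L2_space_sum L2_space_cmult subalgebra_sigma_of[OF assms(1)])
  fix L assume L: "L \<in> Pow M"
  then have "real_cond_exp P (\<A> L) f \<in> L2_space P (\<A> L)"
    using assms by (intro cond_exp_L2 subalgebra_sigma_of) auto
  with L show "real_cond_exp P (\<A> L) f \<in> L2_space P (\<A> M)"
    using L2_space_mono[OF subalgebra_sigma_of_mono] by blast
qed

lemma component_L2_P:
  assumes "M \<subseteq> {1..}" "f \<in> L2_space P P"
  shows "Hoeffding_component P E X f M \<in> L2_space P P"
  by (rule L2_space_mono[OF subalgebra_sigma_of component_L2]) (rule assms)+

lemma cond_exp_component:
  assumes K: "K \<subseteq> {1..}" and M: "M \<subseteq> {1..}" "finite M" and f: "f \<in> L2_space P P"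
  shows "AE x in P. real_cond_exp P (\<A> K) (Hoeffding_component P E X f M) x =
    (\<Sum>L\<in>Pow M. (-1) ^ (card M - card L) * real_cond_exp P (\<A> (K \<inter> L)) f x)"
proof -
  interpret K: sigma_finite_subalgebra P "\<A> K"
    by (rule sigma_finite_subalgebraI[OF subalgebra_sigma_of[OF K]])
  let ?c = "\<lambda>L. (-1) ^ (card M - card L) :: real"
  \<comment> \<open>Extending the summands by 0 makes them integrable for every index
    \<open>L\<close>, as \<open>real_cond_exp_sum\<close> demands, and not only for subsets of
    \<open>M\<close>.\<close>
  define t where "t = (\<lambda>L x. if L \<subseteq> M then ?c L * real_cond_exp P (\<A> L) f x else 0)"
  have int: "integrable P (real_cond_exp P (\<A> L) f)" if "L \<subseteq> M" for L
    using that M f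
    by (intro sigma_finite_subalgebra.real_cond_exp_int sigma_finite_subalgebraI subalgebra_sigma_of integrable_L2)
       auto
  have "Hoeffding_component P E X f M = (\<lambda>x. \<Sum>L\<in>Pow M. t L x)"
    by (simp add: Hoeffding_component_def t_def)
  moreover have "AE x in P. real_cond_exp P (\<A> K) (\<lambda>x. \<Sum>L\<in>Pow M. t L x) x =
      (\<Sum>L\<in>Pow M. real_cond_exp P (\<A> K) (t L) x)"
  proof (rule K.real_cond_exp_sum)
    show "integrable P (t L)" for L
      by (cases "L \<subseteq> M") (simp_all add: t_def int)
  qed
  moreover have "AE x in P. \<forall>L\<in>Pow M. real_cond_exp P (\<A> K) (t L) x =
      ?c L * real_cond_exp P (\<A> (K \<inter> L)) f x"
  proof (rule AE_finite_allI)
    fix L assume "L \<in> Pow M"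
    then have L: "L \<subseteq> M" "L \<subseteq> {1..}"
      using M by auto
    then have "t L = (\<lambda>x. ?c L * real_cond_exp P (\<A> L) f x)"
      by (simp add: t_def)
    moreover have "AE x in P. real_cond_exp P (\<A> K) (\<lambda>x. ?c L * real_cond_exp P (\<A> L) f x) x =
        ?c L * real_cond_exp P (\<A> K) (real_cond_exp P (\<A> L) f) x"
      by (rule K.real_cond_exp_cmult[OF int[OF L(1)]])
    ultimately show "AE x in P. real_cond_exp P (\<A> K) (t L) x =
        ?c L * real_cond_exp P (\<A> (K \<inter> L)) f x"
      using cond_exp_sigma_of_Int[OF K L(2) integrable_L2[OF f]] by auto
  qed (use M in simp)
  ultimately show ?thesis by auto
qed

text \<open>For \<open>j\<close> in \<open>M\<close> but not in \<open>K\<close>, the sets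
  \<open>K \<inter> insert j L\<close> and \<open>K \<inter> L\<close> coincide, so
  \<open>alternating_sum_Pow_eq_0\<close> applies.\<close>

lemma cond_exp_component_eq_0:
  assumes "K \<subseteq> {1..}" "M \<subseteq> {1..}" "finite M" "f \<in> L2_space P P" and "\<not> M \<subseteq> K"
  shows "AE x in P. real_cond_exp P (\<A> K) (Hoeffding_component P E X f M) x = 0"
proof -
  obtain j where j: "j \<in> M" "j \<notin> K"
    using assms by auto
  have "(\<Sum>L\<in>Pow M. (-1) ^ (card M - card L) * real_cond_exp P (\<A> (K \<inter> L)) f x) = 0" for x
    using j by (intro alternating_sum_Pow_eq_0[OF \<open>finite M\<close>]) auto
  then show ?thesis
    using cond_exp_component[OF assms(1-4)] by simp
qed

text \<open>The identity holds at every point, not just almost everywhere, because all components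
  are built from the same versions of the conditional expectations.\<close>

lemma sum_components:
  assumes "finite M"
  shows "(\<Sum>N\<in>Pow M. Hoeffding_component P E X f N x) = real_cond_exp P (\<A> M) f x"
  unfolding Hoeffding_component_def by (rule Moebius_inversion_Pow[OF assms])

lemma integral_component_mult_cond_exp:
  assumes N: "N \<subseteq> {1..}" and f: "f \<in> L2_space P P" and g: "g \<in> L2_space P P"
  shows "(\<integral>x. Hoeffding_component P E X f N x * g x \<partial>P) =
    (\<integral>x. Hoeffding_component P E X f N x * real_cond_exp P (\<A> N) g x \<partial>P)"
proof -
  interpret N: sigma_finite_subalgebra P "\<A> N"
    by (rule sigma_finite_subalgebraI[OF subalgebra_sigma_of[OF N]])
  show ?thesis
    using component_L2[OF N f] g
    by (intro N.real_cond_exp_intg(2)[symmetric] integrable_mult_L2 component_L2_P[OF N f])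
       (auto simp: L2_space_def)
qed

text \<open>Of two distinct index sets, one is not contained in the other. If \<open>M\<close> is
  not contained in \<open>N\<close>, conditioning on \<open>\<A> N\<close> inside the integral
  annihilates the component of \<open>M\<close>.\<close>

lemma components_orthogonal:
  assumes M: "M \<in> Fpow {1..}" and N: "N \<in> Fpow {1..}" and "M \<noteq> N" and f: "f \<in> L2_space P P"
  shows "(\<integral>x. Hoeffding_component P E X f M x * Hoeffding_component P E X f N x \<partial>P) = 0"
proof -
  have *: "(\<integral>x. Hoeffding_component P E X f N x * Hoeffding_component P E X f M x \<partial>P) = 0"
    if "M \<in> Fpow {1..}" "N \<in> Fpow {1..}" "\<not> M \<subseteq> N" for M N
  proof -
    have M: "M \<subseteq> {1..}" "finite M" and N: "N \<subseteq> {1..}"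
      using that by (auto simp: Fpow_def)
    have "(\<integral>x. Hoeffding_component P E X f N x * Hoeffding_component P E X f M x \<partial>P) =
      (\<integral>x. Hoeffding_component P E X f N x * real_cond_exp P (\<A> N) (Hoeffding_component P E X f M) x \<partial>P)"
      by (rule integral_component_mult_cond_exp[OF N f component_L2_P[OF M(1) f]])
    also have "\<dots> = 0"
      using cond_exp_component_eq_0[OF N M f \<open>\<not> M \<subseteq> N\<close>] by (intro integral_eq_zero_AE) auto
    finally show ?thesis .
  qed
  show ?thesis
    using *[OF M N] *[OF N M] \<open>M \<noteq> N\<close> by (cases "M \<subseteq> N") (auto simp: mult.commute)
qed

text \<open>Conditioning on \<open>\<A> N\<close> replaces \<open>f\<close> by the sum of its
  components over subsets of \<open>N\<close>, of which orthogonality leaves only the one for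
  \<open>N\<close>.\<close>

lemma integral_component_mult:
  assumes N: "N \<in> Fpow {1..}" and f: "f \<in> L2_space P P"
  shows "(\<integral>x. Hoeffding_component P E X f N x * f x \<partial>P) = (\<integral>x. (Hoeffding_component P E X f N x)\<^sup>2 \<partial>P)"
proof -
  let ?c = "Hoeffding_component P E X f"
  have N': "N \<subseteq> {1..}" "finite N"
    using N by (auto simp: Fpow_def)
  have "(\<integral>x. ?c N x * f x \<partial>P) = (\<integral>x. ?c N x * (\<Sum>L\<in>Pow N. ?c L x) \<partial>P)"
    unfolding sum_components[OF N'(2)] by (rule integral_component_mult_cond_exp[OF N'(1) f f])
  also have "\<dots> = (\<Sum>L\<in>Pow N. \<integral>x. ?c N x * ?c L x \<partial>P)"
    unfolding sum_distrib_left using N'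
    by (intro Bochner_Integration.integral_sum integrable_mult_L2 component_L2_P f) auto
  also have "\<dots> = (\<Sum>L\<in>Pow N. if L = N then \<integral>x. (?c N x)\<^sup>2 \<partial>P else 0)"
    using N by (intro sum.cong) (auto simp: power2_eq_square Fpow_def finite_subset intro!: components_orthogonal f)
  also have "\<dots> = (\<integral>x. (?c N x)\<^sup>2 \<partial>P)"
    using N' by (simp add: sum.delta)
  finally show ?thesis .
qed

text \<open>Bessel's identity: the inner products of the partial sum \<open>s\<close> with
  \<open>f\<close> and with itself both equal \<open>q\<close>. In particular, enlarging
  \<open>S\<close> never increases the remainder.\<close>

lemma integral_remainder_square:
  assumes S: "finite S" "S \<subseteq> Fpow {1..}" and f: "f \<in> L2_space P P"
  shows "(\<integral>x. (f x - (\<Sum>M\<in>S. Hoeffding_component P E X f M x))\<^sup>2 \<partial>P) =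
    (\<integral>x. (f x)\<^sup>2 \<partial>P) - (\<Sum>M\<in>S. \<integral>x. (Hoeffding_component P E X f M x)\<^sup>2 \<partial>P)"
proof -
  let ?c = "Hoeffding_component P E X f"
  define s where "s = (\<lambda>x. \<Sum>M\<in>S. ?c M x)"
  define q where "q = (\<Sum>M\<in>S. \<integral>x. (?c M x)\<^sup>2 \<partial>P)"
  have c: "?c M \<in> L2_space P P" if "M \<in> S" for M
    using that S f by (intro component_L2_P) (auto simp: Fpow_def)
  have s: "s \<in> L2_space P P"
    unfolding s_def by (intro L2_space_sum c) auto
  have fs: "(\<integral>x. s x * f x \<partial>P) = q"
  proof -
    have "(\<integral>x. s x * f x \<partial>P) = (\<Sum>M\<in>S. \<integral>x. ?c M x * f x \<partial>P)"
      unfolding s_def sum_distrib_right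
      by (intro Bochner_Integration.integral_sum integrable_mult_L2 c f)
    then show ?thesis
      unfolding q_def using S f by (simp add: integral_component_mult subset_iff)
  qed
  have ss: "(\<integral>x. s x * s x \<partial>P) = q"
  proof -
    have "(\<integral>x. ?c M x * s x \<partial>P) = (\<integral>x. (?c M x)\<^sup>2 \<partial>P)" if M: "M \<in> S" for M
    proof -
      have "(\<integral>x. ?c M x * s x \<partial>P) = (\<Sum>N\<in>S. \<integral>x. ?c M x * ?c N x \<partial>P)"
        unfolding s_def sum_distrib_left
        by (intro Bochner_Integration.integral_sum integrable_mult_L2 c M)
      also have "\<dots> = (\<Sum>N\<in>S. if N = M then \<integral>x. (?c M x)\<^sup>2 \<partial>P else 0)"
        using S M by (intro sum.cong) (auto simp: power2_eq_square intro!: components_orthogonal f)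
      finally show ?thesis
        using S M by (simp add: sum.delta)
    qed
    moreover have "(\<integral>x. s x * s x \<partial>P) = (\<Sum>M\<in>S. \<integral>x. ?c M x * s x \<partial>P)"
      by (subst (1) s_def, unfold sum_distrib_right)
         (intro Bochner_Integration.integral_sum integrable_mult_L2 c s)
    ultimately show ?thesis
      by (simp add: q_def)
  qed
  have "(\<integral>x. (f x - s x)\<^sup>2 \<partial>P) = (\<integral>x. (f x)\<^sup>2 - 2 * (s x * f x) + s x * s x \<partial>P)"
    by (simp add: power2_eq_square algebra_simps)
  also have "\<dots> = (\<integral>x. (f x)\<^sup>2 \<partial>P) - 2 * (\<integral>x. s x * f x \<partial>P) + (\<integral>x. s x * s x \<partial>P)"
    using f integrable_mult_L2[OF s f] integrable_mult_L2[OF s s]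
    by (simp add: L2_space_square_integrable)
  finally show ?thesis
    unfolding fs ss by (simp add: s_def q_def)
qed

section \<open>Unconditional convergence of the components\<close>

lemma L2_X_L2: "f \<in> L2_X P E X \<Longrightarrow> f \<in> L2_space P P"
  unfolding L2_X_def by (rule L2_space_mono[OF subalgebra_sigma_of]) auto

text \<open>A generator coming from \<open>X j\<close> already lies in \<open>\<A> {1..j}\<close>,
  so these sigma-algebras generate \<open>\<A> {1..}\<close> and some function measurable at a
  finite stage is close to \<open>f\<close>. The conditional expectation at that stage is at least
  as close.\<close>

lemma L2_X_approximation:
  assumes f: "f \<in> L2_X P E X" and "\<epsilon> > 0"
  shows "\<exists>n. (\<integral>x. (f x - real_cond_exp P (\<A> {1..n}) f x)\<^sup>2 \<partial>P) < \<epsilon>"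
proof -
  interpret subalgebra_sequence P "\<lambda>n. \<A> {1..n}"
    by unfold_locales (auto intro: subalgebra_sigma_of subalgebra_sigma_of_mono)
  let ?S = "sigma (space P) (\<Union>n. sets (\<A> {1..n}))"
  have closed: "(\<Union>n. sets (\<A> {1..n})) \<subseteq> Pow (space P)"
    using sets.space_closed[of "\<A> _"] by auto
  have "(\<Union>j\<in>{1..}. {X j -` A \<inter> space P |A. A \<in> sets (E j)}) \<subseteq> (\<Union>n. sets (\<A> {1..n}))"
  proof (rule subsetI)
    fix B assume "B \<in> (\<Union>j\<in>{1..}. {X j -` A \<inter> space P |A. A \<in> sets (E j)})"
    then obtain j where "1 \<le> j" "B \<in> {X j -` A \<inter> space P |A. A \<in> sets (E j)}"
      by auto
    then have "B \<in> sets (\<A> {1..j})"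
      unfolding sets_sigma_of by (intro sigma_sets.Basic UN_I[of j]) auto
    then show "B \<in> (\<Union>n. sets (\<A> {1..n}))" by blast
  qed
  then have "sets (\<A> {1..}) \<subseteq> sets ?S"
    unfolding sets_sigma_of[of P E X "{1..}"] sets_measure_of[OF closed] by (rule sigma_sets_mono')
  then have "subalgebra ?S (\<A> {1..})"
    using closed by (simp add: subalgebra_def space_measure_of)
  then have "f \<in> L2_space P ?S"
    using f unfolding L2_X_def by (rule L2_space_mono)
  then obtain n h where h: "h \<in> L2_space P (\<A> {1..n})" "(\<integral>x. (f x - h x)\<^sup>2 \<partial>P) < \<epsilon>"
    using L2_approximable_generated \<open>\<epsilon> > 0\<close> unfolding L2_approximable_def by blast
  then have "(\<integral>x. (f x - real_cond_exp P (\<A> {1..n}) f x)\<^sup>2 \<partial>P) < \<epsilon>"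
    using cond_exp_best_approximation[OF subalgebra_Fs L2_X_L2[OF f] h(1)] by simp
  then show ?thesis ..
qed

lemma component_has_L2_sum:
  assumes f: "f \<in> L2_X P E X"
  shows "has_L2_sum P (Hoeffding_component P E X f) (Fpow {1..}) f"
  unfolding has_L2_sum_def
proof (intro conjI ballI)
  let ?c = "Hoeffding_component P E X f"
  note f' = L2_X_L2[OF f]
  show "f \<in> L2_space P P" by (rule f')
  show "?c M \<in> L2_space P P" if "M \<in> Fpow {1..}" for M
    using that by (intro component_L2_P f') (auto simp: Fpow_def)
  show "((\<lambda>S. L2_norm P (\<lambda>\<omega>. f \<omega> - (\<Sum>i\<in>S. ?c i \<omega>))) \<longlongrightarrow> 0) (finite_subsets_at_top (Fpow {1..}))"
    unfolding tendsto_iff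
  proof (intro allI impI)
    fix \<epsilon> :: real assume "\<epsilon> > 0"
    then obtain n where n: "(\<integral>x. (f x - real_cond_exp P (\<A> {1..n}) f x)\<^sup>2 \<partial>P) < \<epsilon>\<^sup>2"
      using L2_X_approximation[OF f, of "\<epsilon>\<^sup>2"] by auto
    \<comment> \<open>\<open>Pow {1..n}\<close> is the threshold for the net of finite partial sums:
      its own partial sum is the conditional expectation on \<open>\<A> {1..n}\<close>, and any
      larger \<open>S\<close> has no larger remainder.\<close>
    have Pow: "Pow {1..n} \<subseteq> Fpow {1..}" "finite (Pow {1..n})"
      by (auto simp: Fpow_def finite_subset)
    have "L2_norm P (\<lambda>\<omega>. f \<omega> - (\<Sum>i\<in>S. ?c i \<omega>)) < \<epsilon>"
      if S: "finite S" "Pow {1..n} \<subseteq> S" "S \<subseteq> Fpow {1..}" for S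
    proof -
      have "(\<integral>x. (f x - (\<Sum>M\<in>S. ?c M x))\<^sup>2 \<partial>P) \<le> (\<integral>x. (f x - (\<Sum>M\<in>Pow {1..n}. ?c M x))\<^sup>2 \<partial>P)"
        unfolding integral_remainder_square[OF S(1,3) f'] integral_remainder_square[OF Pow(2,1) f']
        using S by (intro diff_left_mono sum_mono2) auto
      also have "\<dots> < \<epsilon>\<^sup>2"
        using n by (simp only: sum_components[OF finite_atLeastAtMost])
      finally show ?thesis
        unfolding L2_norm_def using \<open>\<epsilon> > 0\<close> by (intro real_less_lsqrt) auto
    qed
    moreover have "0 \<le> L2_norm P g" for g
      by (simp add: L2_norm_def)
    ultimately show "\<forall>\<^sub>F S in finite_subsets_at_top (Fpow {1..}).
        dist (L2_norm P (\<lambda>\<omega>. f \<omega> - (\<Sum>i\<in>S. ?c i \<omega>))) 0 < \<epsilon>"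
      unfolding eventually_finite_subsets_at_top dist_real_def
      using Pow by (intro exI[of _ "Pow {1..n}"]) auto
  qed
qed

text \<open>All defining properties survive a change of version. This is needed because the
  components of \<open>D_op P E X k f\<close> are identified only almost surely.\<close>

theorem infinite_Hoeffding_decomposition_AE:
  assumes f: "f \<in> L2_X P E X"
    and g: "\<And>M. M \<in> Fpow {1..} \<Longrightarrow> g M \<in> L2_space P (\<A> M)"
    and AE_eq: "\<And>M. M \<in> Fpow {1..} \<Longrightarrow> AE \<omega> in P. g M \<omega> = Hoeffding_component P E X f M \<omega>"
  shows "infinite_Hoeffding_decomposition P E X f g"
proof -
  let ?c = "Hoeffding_component P E X f"
  note f' = L2_X_L2[OF f]
  have gP: "g M \<in> L2_space P P" if "M \<in> Fpow {1..}" for M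
    using L2_space_mono[OF subalgebra_sigma_of g[OF that]] that by (auto simp: Fpow_def)
  have cP: "?c M \<in> L2_space P P" if "M \<in> Fpow {1..}" for M
    using that by (intro component_L2_P f') (auto simp: Fpow_def)
  have meas: "g M \<in> borel_measurable P" "?c M \<in> borel_measurable P" if "M \<in> Fpow {1..}" for M
    using gP[OF that] cP[OF that] by (auto simp: L2_space_def)
  have zero: "AE \<omega> in P. real_cond_exp P (\<A> K) (g M) \<omega> = 0"
    if "M \<in> Fpow {1..}" "K \<subseteq> {1..}" "\<not> M \<subseteq> K" for M K
  proof -
    interpret K: sigma_finite_subalgebra P "\<A> K"
      by (rule sigma_finite_subalgebraI[OF subalgebra_sigma_of[OF that(2)]])
    have "AE \<omega> in P. real_cond_exp P (\<A> K) (g M) \<omega> = real_cond_exp P (\<A> K) (?c M) \<omega>"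
      using that by (intro K.real_cond_exp_cong AE_eq meas)
    moreover have "AE \<omega> in P. real_cond_exp P (\<A> K) (?c M) \<omega> = 0"
      using that by (intro cond_exp_component_eq_0 f') (auto simp: Fpow_def)
    ultimately show ?thesis by auto
  qed
  have orth: "(\<integral>\<omega>. g M \<omega> * g N \<omega> \<partial>P) = 0"
    if "M \<in> Fpow {1..}" "N \<in> Fpow {1..}" "M \<noteq> N" for M N
  proof -
    have "(\<integral>\<omega>. g M \<omega> * g N \<omega> \<partial>P) = (\<integral>\<omega>. ?c M \<omega> * ?c N \<omega> \<partial>P)"
      using AE_eq[OF that(1)] AE_eq[OF that(2)] meas[OF that(1)] meas[OF that(2)]
      by (intro integral_cong_AE) auto
    then show ?thesis
      using components_orthogonal[OF that f'] by simp
  qed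
  have norm: "L2_norm P (\<lambda>\<omega>. f \<omega> - (\<Sum>M\<in>S. g M \<omega>)) = L2_norm P (\<lambda>\<omega>. f \<omega> - (\<Sum>M\<in>S. ?c M \<omega>))"
    if S: "finite S" "S \<subseteq> Fpow {1..}" for S
  proof -
    have "AE \<omega> in P. \<forall>M\<in>S. g M \<omega> = ?c M \<omega>"
      using S AE_eq by (intro AE_finite_allI) auto
    then have "AE \<omega> in P. (f \<omega> - (\<Sum>M\<in>S. g M \<omega>))\<^sup>2 = (f \<omega> - (\<Sum>M\<in>S. ?c M \<omega>))\<^sup>2"
      by eventually_elim simp
    moreover have "(\<lambda>\<omega>. \<Sum>M\<in>S. g M \<omega>) \<in> borel_measurable P" "(\<lambda>\<omega>. \<Sum>M\<in>S. ?c M \<omega>) \<in> borel_measurable P"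
      using S meas by (auto intro!: borel_measurable_sum)
    ultimately show ?thesis
      unfolding L2_norm_def using L2_space_measurable[OF f']
      by (intro arg_cong[where f = sqrt] integral_cong_AE) auto
  qed
  have "((\<lambda>S. L2_norm P (\<lambda>\<omega>. f \<omega> - (\<Sum>M\<in>S. ?c M \<omega>))) \<longlongrightarrow> 0) (finite_subsets_at_top (Fpow {1..}))"
    using component_has_L2_sum[OF f] by (simp add: has_L2_sum_def)
  then have "((\<lambda>S. L2_norm P (\<lambda>\<omega>. f \<omega> - (\<Sum>M\<in>S. g M \<omega>))) \<longlongrightarrow> 0) (finite_subsets_at_top (Fpow {1..}))"
    by (rule Lim_transform_eventually) (use norm in \<open>auto intro!: eventually_finite_subsets_at_top_weakI\<close>)
  then have "has_L2_sum P g (Fpow {1..}) f"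
    unfolding has_L2_sum_def using f' gP by blast
  then show ?thesis
    unfolding infinite_Hoeffding_decomposition_def using f g AE_eq zero orth by blast
qed

section \<open>The components of the difference operator\<close>

lemma D_op_L2_X:
  assumes "f \<in> L2_X P E X"
  shows "D_op P E X k f \<in> L2_X P E X"
proof -
  have "real_cond_exp P (\<A> ({1..} - {k})) f \<in> L2_space P (\<A> ({1..} - {k}))"
    by (intro cond_exp_L2 subalgebra_sigma_of L2_X_L2 assms) auto
  then have "real_cond_exp P (\<A> ({1..} - {k})) f \<in> L2_space P (\<A> {1..})"
    by (rule L2_space_mono[OF subalgebra_sigma_of_mono, rotated]) auto
  then show ?thesis
    using assms unfolding D_op_def L2_X_def by (intro L2_space_diff subalgebra_sigma_of) auto
qed

lemma component_D_op:
  assumes f: "f \<in> L2_space P P" and M: "M \<in> Fpow {1..}"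
  shows "AE x in P. Hoeffding_component P E X (D_op P E X k f) M x =
    (if k \<in> M then Hoeffding_component P E X f M x else 0)"
proof -
  let ?c = "Hoeffding_component P E X f"
  let ?K = "{1..} - {k}"
  have K: "?K \<subseteq> {1..}" and M': "M \<subseteq> {1..}" "finite M"
    using M by (auto simp: Fpow_def)
  interpret K: sigma_finite_subalgebra P "\<A> ?K"
    by (rule sigma_finite_subalgebraI[OF subalgebra_sigma_of[OF K]])
  note int = integrable_L2[OF f]
  \<comment> \<open>The subtracted terms, summed with signs over \<open>L\<close>, are the expansion
    of the conditional expectation of \<open>?c M\<close> on \<open>\<A> ?K\<close> in
    \<open>cond_exp_component\<close>.\<close>
  have "AE x in P. \<forall>L\<in>Pow M. real_cond_exp P (\<A> L) (D_op P E X k f) x =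
      real_cond_exp P (\<A> L) f x - real_cond_exp P (\<A> (?K \<inter> L)) f x"
  proof (rule AE_finite_allI)
    fix L assume "L \<in> Pow M"
    then have L: "L \<subseteq> {1..}"
      using M' by auto
    interpret L: sigma_finite_subalgebra P "\<A> L"
      by (rule sigma_finite_subalgebraI[OF subalgebra_sigma_of[OF L]])
    have "AE x in P. real_cond_exp P (\<A> L) (D_op P E X k f) x =
        real_cond_exp P (\<A> L) f x - real_cond_exp P (\<A> L) (real_cond_exp P (\<A> ?K) f) x"
      unfolding D_op_def by (intro L.real_cond_exp_diff int K.real_cond_exp_int)
    then show "AE x in P. real_cond_exp P (\<A> L) (D_op P E X k f) x =
        real_cond_exp P (\<A> L) f x - real_cond_exp P (\<A> (?K \<inter> L)) f x"
      using cond_exp_sigma_of_Int[OF L K int] by (auto simp: Int_commute)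
  qed (use M' in simp)
  then have *: "AE x in P. Hoeffding_component P E X (D_op P E X k f) M x =
      ?c M x - real_cond_exp P (\<A> ?K) (?c M) x"
    using cond_exp_component[OF K M' f]
    by eventually_elim (simp add: Hoeffding_component_def right_diff_distrib sum_subtractf)
  show ?thesis
  proof (cases "k \<in> M")
    case True
    then have "AE x in P. real_cond_exp P (\<A> ?K) (?c M) x = 0"
      by (intro cond_exp_component_eq_0 K M' f) auto
    with * True show ?thesis by auto
  next
    case False
    \<comment> \<open>Here \<open>M \<subseteq> ?K\<close>, so conditioning leaves the component
      unchanged and the difference vanishes.\<close>
    then have "?c M \<in> L2_space P (\<A> ?K)"
      using M' by (intro L2_space_mono[OF subalgebra_sigma_of_mono component_L2] f) auto
    then have "AE x in P. real_cond_exp P (\<A> ?K) (?c M) x = ?c M x"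
      by (intro K.real_cond_exp_F_meas integrable_L2 component_L2_P M' f L2_space_measurable)
    with * False show ?thesis by auto
  qed
qed

end

text \<open>A finite \<open>S \<subseteq> J\<close> that contains \<open>S0 \<inter> J\<close> has
  the same partial sum as \<open>S \<union> S0\<close>: the added indices lie outside
  \<open>J\<close>, where \<open>g\<close> is zero. Thus \<open>S0 \<inter> J\<close> serves as
  threshold for \<open>J\<close>.\<close>

lemma has_L2_sum_mono_neutral:
  assumes sum: "has_L2_sum P g I s" and "J \<subseteq> I"
    and zero: "\<And>i. i \<in> I - J \<Longrightarrow> g i = (\<lambda>\<omega>. 0)" and eq: "\<And>i. i \<in> J \<Longrightarrow> g i = h i"
  shows "has_L2_sum P h J s"
proof -
  have transfer: "\<forall>\<^sub>F S in finite_subsets_at_top J. Q (L2_norm P (\<lambda>\<omega>. s \<omega> - (\<Sum>i\<in>S. h i \<omega>)))"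
    if Q: "\<forall>\<^sub>F S in finite_subsets_at_top I. Q (L2_norm P (\<lambda>\<omega>. s \<omega> - (\<Sum>i\<in>S. g i \<omega>)))" for Q
  proof -
    from Q obtain S0 where S0: "finite S0" "S0 \<subseteq> I"
      and Q0: "\<And>S. finite S \<Longrightarrow> S0 \<subseteq> S \<Longrightarrow> S \<subseteq> I \<Longrightarrow> Q (L2_norm P (\<lambda>\<omega>. s \<omega> - (\<Sum>i\<in>S. g i \<omega>)))"
      unfolding eventually_finite_subsets_at_top by (elim exE conjE) simp
    have "Q (L2_norm P (\<lambda>\<omega>. s \<omega> - (\<Sum>i\<in>S. h i \<omega>)))"
      if S: "finite S" "S0 \<inter> J \<subseteq> S" "S \<subseteq> J" for S
    proof -
      have "(\<Sum>i\<in>S \<union> S0. g i \<omega>) = (\<Sum>i\<in>S. g i \<omega>)" for \<omega>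
      proof (rule sum.mono_neutral_right)
        show "\<forall>i\<in>S \<union> S0 - S. g i \<omega> = 0"
        proof
          fix i assume "i \<in> S \<union> S0 - S"
          then have "i \<in> I - J"
            using S S0 by blast
          then show "g i \<omega> = 0"
            by (simp add: zero)
        qed
      qed (use S S0 in auto)
      moreover have "(\<Sum>i\<in>S. g i \<omega>) = (\<Sum>i\<in>S. h i \<omega>)" for \<omega>
        using S eq by (intro sum.cong) auto
      ultimately show ?thesis
        using Q0[of "S \<union> S0"] S S0 \<open>J \<subseteq> I\<close> by (simp add: subset_trans[of S J I])
    qed
    then show ?thesis
      unfolding eventually_finite_subsets_at_top using S0 by (intro exI[of _ "S0 \<inter> J"]) auto
  qed
  have "((\<lambda>S. L2_norm P (\<lambda>\<omega>. s \<omega> - (\<Sum>i\<in>S. h i \<omega>))) \<longlongrightarrow> 0) (finite_subsets_at_top J)"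
  proof (rule topological_tendstoI)
    fix U :: "real set" assume "open U" "0 \<in> U"
    with sum show "\<forall>\<^sub>F S in finite_subsets_at_top J. L2_norm P (\<lambda>\<omega>. s \<omega> - (\<Sum>i\<in>S. h i \<omega>)) \<in> U"
      unfolding has_L2_sum_def by (intro transfer[of "\<lambda>r. r \<in> U"] topological_tendstoD) auto
  qed
  moreover have "h i \<in> L2_space P P" if "i \<in> J" for i
    using sum eq[OF that] that \<open>J \<subseteq> I\<close> unfolding has_L2_sum_def by (metis subsetD)
  ultimately show ?thesis
    using sum unfolding has_L2_sum_def by blast
qed

theorem proposition2p3:
  fixes P :: "'a measure" and E :: "nat \<Rightarrow> 'b measure" and X :: "nat \<Rightarrow> 'a \<Rightarrow> 'b"
    and F :: "'a \<Rightarrow> real" and k :: nat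
  assumes "prob_space P"
    and "\<And>n. n \<in> {1..} \<Longrightarrow> prob_space (E n)"
    and "prob_space.indep_vars P E X {1..}"
    and "\<And>n. n \<in> {1..} \<Longrightarrow> distr P (E n) (X n) = E n"
    and "F \<in> L2_X P E X"
    and "k \<in> {1..}"
  shows "infinite_Hoeffding_decomposition P E X (D_op P E X k F)
           (\<lambda>M. if k \<in> M then Hoeffding_component P E X F M else (\<lambda>\<omega>. 0)) \<and>
         has_L2_sum P (Hoeffding_component P E X F) {M \<in> Fpow {1..}. k \<in> M} (D_op P E X k F)"
proof
  interpret independent_sequence P E X
    using assms by (simp add: independent_sequence_def independent_sequence_axioms_def)
  \<comment> \<open>The family is the zero function itself for \<open>k \<notin> M\<close>, not just
    almost surely zero, so \<open>has_L2_sum_mono_neutral\<close> can drop these indices.\<close>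
  let ?g = "\<lambda>M. if k \<in> M then Hoeffding_component P E X F M else (\<lambda>\<omega>. 0)"
  note F = L2_X_L2[OF assms(5)]
  show decomposition: "infinite_Hoeffding_decomposition P E X (D_op P E X k F) ?g"
  proof (rule infinite_Hoeffding_decomposition_AE[OF D_op_L2_X[OF assms(5)]])
    fix M :: "nat set" assume M: "M \<in> Fpow {1..}"
    then show "?g M \<in> L2_space P (\<A> M)"
      using component_L2[OF _ F] by (auto simp: Fpow_def)
    show "AE \<omega> in P. ?g M \<omega> = Hoeffding_component P E X (D_op P E X k F) M \<omega>"
      using component_D_op[OF F M, of k] by eventually_elim simp
  qed
  show "has_L2_sum P (Hoeffding_component P E X F) {M \<in> Fpow {1..}. k \<in> M} (D_op P E X k F)"
    by (rule has_L2_sum_mono_neutral[where g = ?g and I = "Fpow {1..}"])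
       (use decomposition in \<open>auto simp: infinite_Hoeffding_decomposition_def\<close>)
qed

end
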